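(* Let $\mu$ be a non-zero, finite, compactly supported Borel measure on $\mathbb{R}^d$. If $q=\frac2\theta$ for some $\theta\in(0,1]$ such that $\mathcal{J}_{d\theta,\theta}(\mu)=\infty$, and $p\in[1,\infty]$, then for $f=1$, $$\|\widehat{f\mu}\|_{L^q(\mathbb{R}^d)}=\infty>\|f\|_{L^p(\mu)}=\mu(\mathbb{R}^d)^{1/p}.$$ Hence, for this $q$, the restriction estimate $$\|\widehat g\|_{L^{p'}(\mu)}\lesssim\|g\|_{L^{q'}(\mathbb{R}^d)}\qquad\text{for all } g\in L^{q'}(\mathbb{R}^d)$$ does not hold for any $p\in[1,\infty]$. In particular, this restriction estimate does not hold for any $p\in[1,\infty]$ if $q\in[1,\infty]$ satisfies $$q<\sup\Big\{\frac2\theta:\ \theta\in(0,1],\ \dim^\theta_{\mathrm F}\mu<d\theta\Big\}.$$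
   Context: $A\lesssim B$ means $A\leq CB$ with a constant $C>0$ independent of the function. $p',q'$ are the conjugate exponents of $p,q$. Fourier transforms: $\widehat g(\xi)=\int_{\mathbb{R}^d}e^{-2\pi i\xi\cdot x}g(x)\,dx$, $\widehat\mu(\xi)=\int e^{-2\pi i\xi\cdot x}\,d\mu(x)$, $\widehat{f\mu}(\xi)=\int e^{-2\pi i\xi\cdot x}f(x)\,d\mu(x)$. The restriction estimate is understood as an estimate with a uniform constant tested on Schwartz functions $g$ (extended by density when possible). For $p=\infty$, $\mu(\mathbb{R}^d)^{1/p}=1$. For $\theta\in(0,1]$, $\mathcal{J}_{s,\theta}(\mu)=\Big(\int_{\mathbb{R}^d}|\widehat\mu(\xi)|^{2/\theta}|\xi|^{s/\theta-d}\,d\xi\Big)^\theta$, and the Fourier spectrum is $\dim^\theta_{\mathrm F}\mu=\sup\{s\in\mathbb{R}:\mathcal{J}_{s,\theta}(\mu)<\infty\}$ (with value $0$ if the set is empty). If the set in the final supremum is empty, the last assertion is vacuous. *)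

theory Defs
  imports "HOL-Analysis.Analysis" "HOL-Probability.Essential_Supremum"
begin

(* Used for a > 0, and for a = 0 only with x a positive finite number, so that the value
   at infinity is the expected one and Isabelle's convention 0 powr 0 = 0 plays no role. *)
definition ennreal_powr :: "ennreal \<Rightarrow> real \<Rightarrow> ennreal" where
  "ennreal_powr x a = (if x = \<infinity> then \<infinity> else ennreal (enn2real x powr a))"

(* The L^p(M) norm of f for an exponent 1 <= p <= infinity, with value infinity allowed. *)
definition Lp_norm :: "ennreal \<Rightarrow> 'a measure \<Rightarrow> ('a \<Rightarrow> complex) \<Rightarrow> ennreal" where
  "Lp_norm p M f =
     (if p = \<infinity> then esssup M (\<lambda>x. ennreal (norm (f x)))
      else ennreal_powr (\<integral>\<^sup>+ x. ennreal (norm (f x) powr enn2real p) \<partial>M) (1 / enn2real p))"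

(* In ennreal, inverse 0 = infinity and inverse infinity = 0, which covers p = 1 and p = infinity. *)
definition conj_exponent :: "ennreal \<Rightarrow> ennreal" where
  "conj_exponent p = inverse (1 - inverse p)"

lemma conj_exponent_sum:
  assumes "1 \<le> p"
  shows "inverse p + inverse (conj_exponent p) = 1"
proof -
  have inv: "inverse (inverse x) = x" for x :: ennreal
  proof (cases x)
    case (real r)
    then show ?thesis
      by (cases "r = 0") (simp_all add: inverse_ennreal)
  qed simp
  have "inverse p \<le> 1"
  proof (cases p)
    case (real r)
    with assms show ?thesis
      by (simp add: inverse_ennreal inverse_le_1_iff)
  qed simp
  then show ?thesis
    unfolding conj_exponent_def inv by (simp add: add_diff_inverse_ennreal)
qed

(* The Fourier transform of the complex measure f M.  For M = lborel it is the Fourier transform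
   of the function f; for f = 1 it is the Fourier transform of the measure M. *)
definition fourier :: "'a::euclidean_space measure \<Rightarrow> ('a \<Rightarrow> complex) \<Rightarrow> 'a \<Rightarrow> complex" where
  "fourier M f \<xi> = (LINT x|M. exp (- 2 * of_real pi * \<i> * of_real (\<xi> \<bullet> x)) * f x)"

definition measure_support :: "'a::topological_space measure \<Rightarrow> 'a set" where
  "measure_support \<mu> = {x. \<forall>U. open U \<and> x \<in> U \<longrightarrow> emeasure \<mu> U > 0}"

(* The order of differentiation is given by a list of directions. *)
fun iterated_deriv :: "'a list \<Rightarrow> ('a::euclidean_space \<Rightarrow> complex) \<Rightarrow> 'a \<Rightarrow> complex" where
  "iterated_deriv [] f = f"
| "iterated_deriv (v # vs) f = (\<lambda>x. frechet_derivative (iterated_deriv vs f) (at x) v)"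

(* Differentiability of all iterated partial derivatives amounts to smoothness. *)
definition schwartz :: "('a::euclidean_space \<Rightarrow> complex) \<Rightarrow> bool" where
  "schwartz f \<longleftrightarrow>
     (\<forall>vs \<in> lists Basis.
        (\<forall>x. iterated_deriv vs f differentiable (at x)) \<and>
        (\<forall>N::nat. bounded (range (\<lambda>x. norm x ^ N *\<^sub>R iterated_deriv vs f x))))"

(* The estimate with exponents p', q' and a constant that does not depend on the test function. *)
definition restriction_estimate :: "'a::euclidean_space measure \<Rightarrow> ennreal \<Rightarrow> ennreal \<Rightarrow> bool" where
  "restriction_estimate \<mu> p q \<longleftrightarrow>
     (\<exists>C::real. C > 0 \<and>
       (\<forall>g. schwartz g \<longrightarrow>
          Lp_norm (conj_exponent p) \<mu> (fourier lborel g)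
            \<le> ennreal C * Lp_norm (conj_exponent q) lborel g))"

definition energy_J :: "real \<Rightarrow> real \<Rightarrow> 'a::euclidean_space measure \<Rightarrow> ennreal" where
  "energy_J s \<theta> \<mu> =
     ennreal_powr
       (\<integral>\<^sup>+ \<xi>. ennreal (norm (fourier \<mu> (\<lambda>_. 1) \<xi>) powr (2 / \<theta>)
                   * norm \<xi> powr (s / \<theta> - real DIM('a))) \<partial>lborel) \<theta>"

(* The supremum is taken in ereal because the set may be unbounded above. *)
definition fourier_spectrum :: "real \<Rightarrow> 'a::euclidean_space measure \<Rightarrow> ereal" where
  "fourier_spectrum \<theta> \<mu> =
     (if {s. energy_J s \<theta> \<mu> < \<infinity>} = {} then 0
      else Sup (ereal ` {s. energy_J s \<theta> \<mu> < \<infinity>}))"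

end

theory Submission
  imports Defs "HOL-Probability.Probability"
begin

text \<open>
  Let \<open>F\<close> be the Fourier transform of \<open>\<mu>\<close>.  Since \<open>\<mu>\<close> is finite, a restriction estimate and Fubini's
  theorem bound \<open>\<integral> g F\<close> by a multiple of the \<open>L^q'\<close> norm of \<open>g\<close>, for all Schwartz functions \<open>g\<close>.
  As \<open>\<mu>\<close> has compact support, \<open>F\<close> is smooth with bounded derivatives, so
  \<open>g = cnj F (|F|^2 + \<delta>)^((q - 2) / 2) exp (- \<epsilon> |x|^2)\<close> is a Schwartz function, without any density
  argument.  Letting first \<open>\<delta>\<close> and then \<open>\<epsilon>\<close> tend to zero gives \<open>F \<in> L^q\<close>.  Because \<open>F\<close> is
  bounded, this contradicts the divergence of the energy for every finite exponent up to \<open>2 / \<theta>\<close>.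
\<close>

section \<open>Support of the measure and Gaussian estimates\<close>

lemma AE_in_measure_support:
  fixes \<mu> :: "'a::euclidean_space measure"
  assumes sets: "sets \<mu> = sets borel"
  shows "AE x in \<mu>. x \<in> measure_support \<mu>"
proof -
  define \<F> where "\<F> = {U :: 'a set. open U \<and> emeasure \<mu> U = 0}"
  \<comment> \<open>The complement of the support is the union of all open null sets. This union may
    be uncountable; Lindelof reduces it to a countable one, which is null.\<close>
  obtain \<F>' where F': "\<F>' \<subseteq> \<F>" "countable \<F>'" "\<Union>\<F>' = \<Union>\<F>"
    by (rule Lindelof[of \<F>]) (auto simp: \<F>_def)
  have "(\<Union>U\<in>\<F>'. U) \<in> null_sets \<mu>"
    using F' by (intro null_sets_UN') (auto simp: \<F>_def sets intro!: null_setsI)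
  then have "\<Union>\<F>' \<in> null_sets \<mu>"
    by simp
  moreover have "- measure_support \<mu> \<subseteq> \<Union>\<F>'"
    unfolding F' by (auto simp: measure_support_def \<F>_def not_gr_zero)
  ultimately show ?thesis
    by (intro AE_I'[of "\<Union>\<F>'"]) auto
qed

text \<open>Second-order Taylor remainder of the phase; it supplies the quadratic error term in
  \<open>fourier_has_derivative\<close>.\<close>

lemma norm_cis_linear_approx: "norm (cis t - 1 - \<i> * of_real t) \<le> t\<^sup>2 / 2"
  using iexp_approx1[of t 1]
  by (simp add: cis_conv_exp mult.commute algebra_simps numeral_2_eq_2)

lemma borel_measurable_cis [measurable]: "cis \<in> borel_measurable borel"
  by (intro borel_measurable_continuous_onI continuous_intros)

lemma fourier_cis: "fourier M f \<xi> = (LINT x|M. cis (- 2 * pi * (\<xi> \<bullet> x)) * f x)"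
  unfolding fourier_def cis_conv_exp by (simp add: ac_simps)

lemma integrable_gaussian_euclidean:
  assumes "0 < \<epsilon>"
  shows "integrable lborel (\<lambda>x::'a::euclidean_space. exp (- \<epsilon> * (norm x)\<^sup>2))"
proof -
  \<comment> \<open>Chosen so that 1 / (2 \<sigma>^2) = \<epsilon>: the one-dimensional Gaussian is
    a multiple of a normal density. The general case follows by Tonelli, since the Gaussian factors
    over \<open>Basis\<close>.\<close>
  define \<sigma> where "\<sigma> = sqrt (1 / (2 * \<epsilon>))"
  have \<sigma>: "\<sigma> > 0" "\<sigma>\<^sup>2 = 1 / (2 * \<epsilon>)"
    using assms by (auto simp: \<sigma>_def)
  have "integrable lborel (\<lambda>t. sqrt (2 * pi * \<sigma>\<^sup>2) * normal_density 0 \<sigma> t)"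
    using \<sigma> by (intro integrable_mult_right integrable_normal_density)
  moreover have "sqrt (2 * pi * \<sigma>\<^sup>2) * normal_density 0 \<sigma> t = exp (- \<epsilon> * t\<^sup>2)" for t
    using \<sigma> assms by (simp add: normal_density_def)
  ultimately have "integrable lborel (\<lambda>t::real. exp (- \<epsilon> * t\<^sup>2))"
    by simp
  then have fin: "(\<integral>\<^sup>+ t. ennreal (exp (- \<epsilon> * t\<^sup>2)) \<partial>lborel) < \<infinity>"
    by (simp add: integrable_iff_bounded)
  have eq: "ennreal (exp (- \<epsilon> * (norm x)\<^sup>2)) = (\<Prod>b\<in>Basis. ennreal (exp (- \<epsilon> * (x \<bullet> b)\<^sup>2)))" for x :: 'a
  proof -
    have "(norm x)\<^sup>2 = (\<Sum>b\<in>Basis. (x \<bullet> b)\<^sup>2)"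
      by (subst power2_norm_eq_inner, subst euclidean_inner) (simp add: power2_eq_square)
    then show ?thesis
      by (simp add: sum_distrib_left exp_sum prod_ennreal flip: sum_negf)
  qed
  have "(\<integral>\<^sup>+ x. ennreal (exp (- \<epsilon> * (norm x)\<^sup>2)) \<partial>(lborel :: 'a measure))
      = (\<Prod>b\<in>(Basis::'a set). (\<integral>\<^sup>+ t. ennreal (exp (- \<epsilon> * t\<^sup>2)) \<partial>lborel))"
    unfolding eq by (rule nn_integral_lborel_prod) auto
  also have "\<dots> < \<infinity>"
    using fin by (simp add: ennreal_prod_eq_top power_less_top_ennreal)
  finally show ?thesis
    by (intro integrableI_bounded) auto
qed

text \<open>From 1 + s \<le> exp s the polynomial is at most exp (k s), and completing the square in
  k s - \<epsilon> s^2 yields the constant exp (k^2 / (4 \<epsilon>)).\<close>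

lemma bounded_power_mult_gaussian:
  fixes \<epsilon> :: real and k :: nat
  assumes "0 < \<epsilon>"
  shows "\<exists>C. \<forall>s\<ge>0. (1 + s) ^ k * exp (- \<epsilon> * s\<^sup>2) \<le> C"
proof (intro exI allI impI)
  fix s :: real assume "s \<ge> 0"
  then have "(1 + s) ^ k \<le> exp s ^ k"
    by (intro power_mono) (auto simp: exp_ge_add_one_self)
  then have *: "(1 + s) ^ k \<le> exp (k * s)"
    by (simp add: exp_of_nat_mult)
  have "0 \<le> (real k - 2 * \<epsilon> * s)\<^sup>2 / (4 * \<epsilon>)"
    using assms by simp
  also have "\<dots> = k\<^sup>2 / (4 * \<epsilon>) - k * s + \<epsilon> * s\<^sup>2"
    using assms by (simp add: field_simps power2_eq_square)
  finally have "exp (k * s) * exp (- \<epsilon> * s\<^sup>2) \<le> exp (k\<^sup>2 / (4 * \<epsilon>))"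
    by (simp flip: exp_add)
  then show "(1 + s) ^ k * exp (- \<epsilon> * s\<^sup>2) \<le> exp (k\<^sup>2 / (4 * \<epsilon>))"
    using * by (meson exp_ge_zero mult_right_mono order_trans)
qed

section \<open>Differentiating Fourier transforms of bounded densities\<close>

locale bounded_borel_measure = finite_measure \<mu>
  for \<mu> :: "'a::euclidean_space measure" +
  fixes R :: real
  assumes sets_mu [measurable_cong]: "sets \<mu> = sets borel"
    and AE_norm_le: "AE x in \<mu>. norm x \<le> R"
begin

lemma space_mu [simp]: "space \<mu> = UNIV"
  using sets_eq_imp_space_eq[OF sets_mu] by simp

text \<open>Essentially bounded densities. Differentiating the transform multiplies the density by a
  linear form, so the class must be closed under this; linear forms are bounded only on the ball of
  radius \<open>R\<close>, hence the bound almost everywhere.\<close>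

definition weight :: "('a \<Rightarrow> complex) \<Rightarrow> bool" where
  "weight h \<longleftrightarrow> h \<in> borel_measurable borel \<and> (\<exists>B. AE x in \<mu>. norm (h x) \<le> B)"

lemma weight_integrable:
  assumes "weight h"
  shows "integrable \<mu> h"
  using assms by (auto simp: weight_def measurable_cong_sets[OF sets_mu refl] intro: integrable_const_bound)

lemma weight_mult:
  assumes "weight g" "weight h"
  shows "weight (\<lambda>x. g x * h x)"
proof -
  obtain A B where "AE x in \<mu>. norm (g x) \<le> A" "AE x in \<mu>. norm (h x) \<le> B"
    using assms by (auto simp: weight_def)
  then have "AE x in \<mu>. norm (g x * h x) \<le> \<bar>A\<bar> * \<bar>B\<bar>"
    by eventually_elim (auto simp: norm_mult intro!: mult_mono)
  then show ?thesis
    using assms by (auto simp: weight_def)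
qed

lemma weight_bounded:
  assumes "h \<in> borel_measurable borel" "\<And>x. norm (h x) \<le> B"
  shows "weight h"
  using assms by (auto simp: weight_def)

lemma weight_inner: "weight (\<lambda>x. of_real (v \<bullet> x))"
proof -
  have "AE x in \<mu>. norm (of_real (v \<bullet> x) :: complex) \<le> norm v * R"
    using AE_norm_le
    by eventually_elim (metis norm_of_real Cauchy_Schwarz_ineq2 mult_left_mono norm_ge_zero order_trans)
  then show ?thesis
    by (auto simp: weight_def)
qed

lemma weight_cis: "weight (\<lambda>x. cis (a * (v \<bullet> x)))"
  by (rule weight_bounded[where B = 1]) auto

lemma fourier_bounded:
  assumes "weight h"
  shows "\<exists>B. \<forall>\<xi>. norm (fourier \<mu> h \<xi>) \<le> B"
proof (intro exI allI)
  fix \<xi>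
  have "norm (fourier \<mu> h \<xi>) \<le> (LINT x|\<mu>. norm (cis (- 2 * pi * (\<xi> \<bullet> x)) * h x))"
    unfolding fourier_cis by (rule integral_norm_bound)
  then show "norm (fourier \<mu> h \<xi>) \<le> (LINT x|\<mu>. norm (h x))"
    by (simp add: norm_mult)
qed

text \<open>Differentiation under the integral sign, with an explicit error: the Taylor remainder of
  the phase is quadratic in the increment, uniformly for |x| \<le> \<open>R\<close>. The derivative
  in a fixed direction is again the transform of a weight, so the lemma can be iterated.\<close>

lemma fourier_has_derivative:
  assumes h: "weight h"
  shows "(fourier \<mu> h has_derivative
           (\<lambda>\<eta>. fourier \<mu> (\<lambda>x. \<i> * of_real (- 2 * pi) * (of_real (\<eta> \<bullet> x) * h x)) \<xi>)) (at \<xi>)"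
    (is "(_ has_derivative ?D) _")
proof -
  obtain B where B: "AE x in \<mu>. norm (h x) \<le> B"
    using h by (auto simp: weight_def)
  have B': "AE x in \<mu>. norm (h x) \<le> \<bar>B\<bar>"
    using B by eventually_elim simp
  have int: "integrable \<mu> (\<lambda>x. cis (- 2 * pi * (\<xi> \<bullet> x)) * (of_real (\<eta> \<bullet> x) * h x))" for \<eta>
    by (intro weight_integrable weight_mult weight_cis weight_inner h)
  have D: "?D \<eta> = \<i> * of_real (- 2 * pi) * (LINT x|\<mu>. cis (- 2 * pi * (\<xi> \<bullet> x)) * (of_real (\<eta> \<bullet> x) * h x))" for \<eta>
    unfolding fourier_cis
    by (subst integral_mult_right_zero[symmetric]) (simp only: ac_simps)
  have lin: "bounded_linear ?D"
  proof (rule linear_conv_bounded_linear[THEN iffD1], rule linearI)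
    show "?D (a + b) = ?D a + ?D b" for a b
      unfolding D by (simp only: inner_add_left of_real_add distrib_right distrib_left Bochner_Integration.integral_add int)
    show "?D (r *\<^sub>R b) = r *\<^sub>R ?D b" for r b
    proof -
      have "(LINT x|\<mu>. cis (- 2 * pi * (\<xi> \<bullet> x)) * (of_real ((r *\<^sub>R b) \<bullet> x) * h x))
          = (LINT x|\<mu>. of_real r * (cis (- 2 * pi * (\<xi> \<bullet> x)) * (of_real (b \<bullet> x) * h x)))"
        by (simp add: ac_simps)
      also have "\<dots> = of_real r * (LINT x|\<mu>. cis (- 2 * pi * (\<xi> \<bullet> x)) * (of_real (b \<bullet> x) * h x))"
        by (rule integral_mult_right_zero)
      finally show ?thesis
        unfolding D by (simp add: scaleR_conv_of_real)
    qed
  qed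
  \<comment> \<open>The remainder is at most t^2 / 2 with |t| \<le> 2 pi R |\<eta>|; the density
    contributes the factor |B| and integration the total mass.\<close>
  define K where "K = (2 * pi * R)\<^sup>2 / 2 * \<bar>B\<bar> * measure \<mu> UNIV"
  have bound: "norm (fourier \<mu> h y - fourier \<mu> h \<xi> - ?D (y - \<xi>)) \<le> K * (norm (y - \<xi>))\<^sup>2" for y
  proof -
    define \<eta> where "\<eta> = y - \<xi>"
    define t where "t x = - 2 * pi * (\<eta> \<bullet> x)" for x
    have y: "y = \<xi> + \<eta>" by (simp add: \<eta>_def)
    have i1: "integrable \<mu> (\<lambda>x. cis (- 2 * pi * (y \<bullet> x)) * h x)"
      "integrable \<mu> (\<lambda>x. cis (- 2 * pi * (\<xi> \<bullet> x)) * h x)"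
      by (intro weight_integrable weight_mult weight_cis h)+
    have i2: "integrable \<mu> (\<lambda>x. cis (- 2 * pi * (\<xi> \<bullet> x)) * (\<i> * of_real (- 2 * pi) * (of_real (\<eta> \<bullet> x) * h x)))"
      using integrable_mult_right[OF int, of "\<i> * of_real (- 2 * pi)" \<eta>] by (simp add: ac_simps)
    have cis_y: "cis (- 2 * pi * (y \<bullet> x)) = cis (- 2 * pi * (\<xi> \<bullet> x)) * cis (t x)" for x
      by (simp add: cis_mult y t_def inner_add_left algebra_simps)
    \<comment> \<open>Pulling out the phase at \<xi>, which has modulus 1, leaves exactly the Taylor
      remainder in \<open>t x\<close>.\<close>
    have eq: "cis (- 2 * pi * (y \<bullet> x)) * h x - cis (- 2 * pi * (\<xi> \<bullet> x)) * h x
            - cis (- 2 * pi * (\<xi> \<bullet> x)) * (\<i> * of_real (- 2 * pi) * (of_real (\<eta> \<bullet> x) * h x))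
          = cis (- 2 * pi * (\<xi> \<bullet> x)) * ((cis (t x) - 1 - \<i> * of_real (t x)) * h x)" (is "_ = ?r x") for x
      unfolding cis_y by (simp add: t_def algebra_simps)
    have diff: "fourier \<mu> h y - fourier \<mu> h \<xi> - ?D \<eta> = (LINT x|\<mu>. ?r x)"
      unfolding fourier_cis eq[symmetric] using i1 i2 by simp
    have "norm (LINT x|\<mu>. ?r x) \<le> (LINT x|\<mu>. norm (?r x))"
      by (rule integral_norm_bound)
    also have "\<dots> \<le> (LINT x|\<mu>. (2 * pi * R)\<^sup>2 / 2 * \<bar>B\<bar> * (norm \<eta>)\<^sup>2)"
    proof (rule integral_mono_AE)
      show "AE x in \<mu>. norm (?r x) \<le> (2 * pi * R)\<^sup>2 / 2 * \<bar>B\<bar> * (norm \<eta>)\<^sup>2"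
        using AE_norm_le B'
      proof eventually_elim
        fix x assume x: "norm x \<le> R" "norm (h x) \<le> \<bar>B\<bar>"
        have "\<bar>\<eta> \<bullet> x\<bar> \<le> norm \<eta> * R"
          using x by (meson Cauchy_Schwarz_ineq2 mult_left_mono norm_ge_zero order_trans)
        then have "\<bar>t x\<bar> \<le> 2 * pi * R * norm \<eta>"
          by (simp add: t_def abs_mult algebra_simps)
        then have "(t x)\<^sup>2 / 2 \<le> (2 * pi * R * norm \<eta>)\<^sup>2 / 2"
          by (metis abs_ge_zero power2_abs power_mono divide_right_mono zero_le_numeral)
        then have "norm (cis (t x) - 1 - \<i> * of_real (t x)) \<le> (2 * pi * R)\<^sup>2 / 2 * (norm \<eta>)\<^sup>2"
          using norm_cis_linear_approx[of "t x"] by (simp add: power_mult_distrib)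
        then have "norm (cis (t x) - 1 - \<i> * of_real (t x)) * norm (h x) \<le> (2 * pi * R)\<^sup>2 / 2 * (norm \<eta>)\<^sup>2 * \<bar>B\<bar>"
          using x by (intro mult_mono) auto
        then show "norm (?r x) \<le> (2 * pi * R)\<^sup>2 / 2 * \<bar>B\<bar> * (norm \<eta>)\<^sup>2"
          by (simp add: norm_mult ac_simps)
      qed
      show "integrable \<mu> (\<lambda>x. norm (?r x))"
        unfolding eq[symmetric] by (intro integrable_norm Bochner_Integration.integrable_diff i1 i2)
    qed simp
    also have "\<dots> = K * (norm \<eta>)\<^sup>2"
      by (simp add: K_def)
    finally show ?thesis
      unfolding diff[symmetric] by (simp only: \<eta>_def)
  qed
  show ?thesis
  proof (rule has_derivativeI_sandwich[where e = 1 and H = "\<lambda>y. K * norm (y - \<xi>)"])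
    show "norm (fourier \<mu> h y - fourier \<mu> h \<xi> - ?D (y - \<xi>)) / norm (y - \<xi>) \<le> K * norm (y - \<xi>)"
      if "y \<noteq> \<xi>" for y
      using bound[of y] that by (simp add: divide_simps power2_eq_square ac_simps)
    have "((\<lambda>y. K * norm (y - \<xi>)) \<longlongrightarrow> K * norm (\<xi> - \<xi>)) (at \<xi>)"
      by (intro tendsto_intros)
    then show "((\<lambda>y. K * norm (y - \<xi>)) \<longlongrightarrow> 0) (at \<xi>)"
      by simp
  qed (simp_all only: lin zero_less_one)
qed

section \<open>Schwartz functions built from the transform of the measure\<close>

abbreviation F :: "'a \<Rightarrow> complex" where
  "F \<equiv> fourier \<mu> (\<lambda>_. 1)"

lemma weight_const: "weight (\<lambda>_. c)"
  by (rule weight_bounded[where B = "norm c"]) auto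

lemma F_has_derivative:
  "(F has_derivative (\<lambda>\<eta>. fourier \<mu> (\<lambda>x. \<i> * of_real (- 2 * pi) * of_real (\<eta> \<bullet> x)) \<xi>)) (at \<xi>)"
  using fourier_has_derivative[OF weight_const[of 1]] by simp

lemma norm_F_le: "norm (F \<xi>) \<le> measure \<mu> UNIV"
proof -
  have "norm (F \<xi>) \<le> (LINT x|\<mu>. norm (cis (- 2 * pi * (\<xi> \<bullet> x)) * 1))"
    unfolding fourier_cis by (rule integral_norm_bound)
  then show ?thesis by simp
qed

text \<open>
  A class of functions of polynomial growth that is closed under directional derivatives and contains
  the regularized powers \<open>(|F|^2 + \<delta>)^a\<close>; multiplied by a Gaussian its members are Schwartz functions.
\<close>

inductive tame :: "('a \<Rightarrow> complex) \<Rightarrow> bool" where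
  tame_const: "tame (\<lambda>_. c)"
| tame_inner: "tame (\<lambda>x. of_real (x \<bullet> v))"
| tame_fourier: "weight h \<Longrightarrow> tame (fourier \<mu> h)"
| tame_cnj: "tame f \<Longrightarrow> tame (\<lambda>x. cnj (f x))"
| tame_add: "tame f \<Longrightarrow> tame g \<Longrightarrow> tame (\<lambda>x. f x + g x)"
| tame_mult: "tame f \<Longrightarrow> tame g \<Longrightarrow> tame (\<lambda>x. f x * g x)"
| tame_powr: "0 < \<delta> \<Longrightarrow> tame (\<lambda>x. of_real (((norm (F x))\<^sup>2 + \<delta>) powr a))"

lemma tame_has_derivative:
  assumes "tame f"
  shows "\<exists>f'. (\<forall>x. (f has_derivative f' x) (at x)) \<and> (\<forall>v. tame (\<lambda>x. f' x v))"
  using assms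
proof induction
  case (tame_const c)
  show ?case
    by (rule exI[of _ "\<lambda>_ _. 0"]) (auto intro: tame.intros)
next
  case (tame_inner v)
  show ?case
    by (rule exI[of _ "\<lambda>_ h. of_real (h \<bullet> v)"])
      (auto intro!: derivative_eq_intros tame.intros)
next
  case (tame_fourier h)
  show ?case
    by (rule exI[of _ "\<lambda>x \<eta>. fourier \<mu> (\<lambda>y. \<i> * of_real (- 2 * pi) * (of_real (\<eta> \<bullet> y) * h y)) x"])
      (intro conjI allI fourier_has_derivative tame_fourier tame.tame_fourier
        weight_mult weight_const weight_inner)
next
  case (tame_cnj f)
  then obtain f' where "\<And>x. (f has_derivative f' x) (at x)" "\<And>v. tame (\<lambda>x. f' x v)"
    by blast
  then show ?case
    by (intro exI[of _ "\<lambda>x h. cnj (f' x h)"])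
      (auto intro!: tame.intros bounded_linear.has_derivative[OF bounded_linear_cnj])
next
  case (tame_add f g)
  then obtain f' g' where "\<And>x. (f has_derivative f' x) (at x)" "\<And>v. tame (\<lambda>x. f' x v)"
    "\<And>x. (g has_derivative g' x) (at x)" "\<And>v. tame (\<lambda>x. g' x v)"
    by blast
  then show ?case
    by (intro exI[of _ "\<lambda>x h. f' x h + g' x h"]) (auto intro!: tame.intros has_derivative_add)
next
  case (tame_mult f g)
  then obtain f' g' where "\<And>x. (f has_derivative f' x) (at x)" "\<And>v. tame (\<lambda>x. f' x v)"
    "\<And>x. (g has_derivative g' x) (at x)" "\<And>v. tame (\<lambda>x. g' x v)"
    by blast
  with tame_mult show ?case
    by (intro exI[of _ "\<lambda>x h. f x * g' x h + f' x h * g x"]) (auto intro!: tame.intros has_derivative_mult)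
next
  case (tame_powr \<delta> a)
  define F' where "F' x \<eta> = fourier \<mu> (\<lambda>y. \<i> * of_real (- 2 * pi) * of_real (\<eta> \<bullet> y)) x" for x \<eta>
  have F': "(F has_derivative F' x) (at x)" for x
    unfolding F'_def by (rule F_has_derivative)
  define G where "G x = (norm (F x))\<^sup>2 + \<delta>" for x
  have G_pos: "G x > 0" for x
    using tame_powr by (simp add: G_def add_nonneg_pos)
  define G' where "G' x \<eta> = Re (F x * cnj (F' x \<eta>) + F' x \<eta> * cnj (F x))" for x \<eta>
  \<comment> \<open>The norm is not differentiable at zeros of \<open>F\<close>; written as the real
    part of \<open>F * cnj F\<close>, its square is differentiable everywhere.\<close>
  have G_eq: "G = (\<lambda>x. Re (F x * cnj (F x)) + \<delta>)"
    unfolding G_def cmod_power2 by (simp add: power2_eq_square)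
  have G': "(G has_derivative G' x) (at x)" for x
    unfolding G_eq G'_def
    by (intro has_derivative_add_const bounded_linear.has_derivative[OF bounded_linear_Re]
        has_derivative_mult bounded_linear.has_derivative[OF bounded_linear_cnj] F')
  have "((\<lambda>x. G x powr a) has_derivative (\<lambda>\<eta>. a * G x powr (a - 1) * G' x \<eta>)) (at x)" for x
  proof -
    have "((\<lambda>x. G x powr a) has_derivative
        (\<lambda>h. (G x powr a) * (0 * ln (G x) + G' x h * a / G x))) (at x)"
      by (rule has_derivative_powr[OF G' has_derivative_const]) (auto simp: G_pos)
    then show ?thesis
      using G_pos[of x] by (simp add: powr_diff ac_simps)
  qed
  then have "((\<lambda>x. complex_of_real (G x powr a)) has_derivative
      (\<lambda>\<eta>. of_real (a * G x powr (a - 1) * G' x \<eta>))) (at x)" for x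
    by (intro bounded_linear.has_derivative[OF bounded_linear_of_real])
  moreover have "tame (\<lambda>x. of_real (a * G x powr (a - 1) * G' x \<eta>))" for \<eta>
  proof -
    \<comment> \<open>The sum of a number and its conjugate is already real, so taking
      \<open>Re\<close> loses nothing and the derivative is expressed through tame
      functions.\<close>
    have "of_real (G' x \<eta>) = F x * cnj (F' x \<eta>) + F' x \<eta> * cnj (F x)" for x
      by (auto simp: G'_def complex_eq_iff)
    moreover have "tame (\<lambda>x. F' x \<eta>)"
      unfolding F'_def by (intro tame.intros weight_mult weight_const weight_inner)
    ultimately show ?thesis
      using tame_powr by (auto simp: G_def intro!: tame.intros weight_const)
  qed
  ultimately show ?case
    unfolding G_def
    by (intro exI[of _ "\<lambda>x \<eta>. of_real (a * ((norm (F x))\<^sup>2 + \<delta>) powr (a - 1) * G' x \<eta>)"] conjI allI)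
qed

text \<open>Only the linear generators grow. Transforms of weights are bounded, and the regularized
  powers have a base between \<delta> and a constant; degrees add under products, and their sum also
  serves for sums.\<close>

lemma tame_growth:
  assumes "tame f"
  shows "\<exists>C k. \<forall>x. norm (f x) \<le> C * (1 + norm x) ^ k"
  using assms
proof induction
  case (tame_const c)
  show ?case
    by (intro exI[of _ "norm c"] exI[of _ 0]) simp
next
  case (tame_inner v)
  have "norm (complex_of_real (x \<bullet> v)) \<le> norm v * (1 + norm x) ^ 1" for x
    using Cauchy_Schwarz_ineq2[of x v] by (simp add: algebra_simps add_increasing)
  then show ?case by blast
next
  case (tame_fourier h)
  then obtain B where "\<forall>\<xi>. norm (fourier \<mu> h \<xi>) \<le> B"
    using fourier_bounded by blast
  then show ?case
    by (intro exI[of _ B] exI[of _ 0]) simp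
next
  case (tame_cnj f)
  then show ?case by simp
next
  case (tame_add f g)
  then obtain C k D l where *: "\<And>x. norm (f x) \<le> C * (1 + norm x) ^ k" "\<And>x. norm (g x) \<le> D * (1 + norm x) ^ l"
    by blast
  have "norm (f x + g x) \<le> (\<bar>C\<bar> + \<bar>D\<bar>) * (1 + norm x) ^ (k + l)" for x
  proof -
    have "(1 + norm x) ^ k \<le> (1 + norm x) ^ (k + l)" "(1 + norm x) ^ l \<le> (1 + norm x) ^ (k + l)"
      by (auto intro!: power_increasing)
    then have "C * (1 + norm x) ^ k \<le> \<bar>C\<bar> * (1 + norm x) ^ (k + l)"
      "D * (1 + norm x) ^ l \<le> \<bar>D\<bar> * (1 + norm x) ^ (k + l)"
      by (auto intro!: mult_mono)
    then show ?thesis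
      using *[of x] norm_triangle_ineq[of "f x" "g x"] by (simp add: distrib_right)
  qed
  then show ?case by blast
next
  case (tame_mult f g)
  then obtain C k D l where *: "\<And>x. norm (f x) \<le> C * (1 + norm x) ^ k" "\<And>x. norm (g x) \<le> D * (1 + norm x) ^ l"
    by blast
  have "norm (f x * g x) \<le> (C * D) * (1 + norm x) ^ (k + l)" for x
  proof -
    have "norm (f x) * norm (g x) \<le> (C * (1 + norm x) ^ k) * (D * (1 + norm x) ^ l)"
      using * by (intro mult_mono) (auto intro: order_trans[OF norm_ge_zero])
    then show ?thesis
      by (simp add: norm_mult power_add ac_simps)
  qed
  then show ?case by blast
next
  case (tame_powr \<delta> a)
  define M where "M = (measure \<mu> UNIV)\<^sup>2 + \<delta>"
  \<comment> \<open>The base lies in [\<delta>, M]. The first summand bounds the power for a \<ge>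
    0, the second for a < 0.\<close>
  have "norm (complex_of_real (((norm (F x))\<^sup>2 + \<delta>) powr a)) \<le> M powr \<bar>a\<bar> + \<delta> powr - \<bar>a\<bar>" for x
  proof -
    define y where "y = (norm (F x))\<^sup>2 + \<delta>"
    have y: "\<delta> \<le> y" "y \<le> M"
      by (auto simp: y_def M_def norm_F_le intro!: power_mono)
    have "y powr a \<le> M powr \<bar>a\<bar> + \<delta> powr - \<bar>a\<bar>"
    proof (cases "a \<ge> 0")
      case True
      then have "y powr a \<le> M powr a" using y tame_powr by (intro powr_mono2) auto
      then show ?thesis using True by (simp add: add_increasing2)
    next
      case False
      then have "y powr a \<le> \<delta> powr a" using y tame_powr by (intro powr_mono2') auto
      then show ?thesis using False by (simp add: add_increasing)
    qed
    then show ?thesis by (simp add: y_def)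
  qed
  then show ?case
    by (intro exI[of _ "M powr \<bar>a\<bar> + \<delta> powr - \<bar>a\<bar>"] exI[of _ 0]) simp
qed

text \<open>Differentiating the Gaussian only brings down the tame factor -2 \<epsilon> (x \<bullet>
  v), so the same Gaussian factors out of every derivative.\<close>

lemma tame_gaussian_has_derivative:
  assumes "tame f"
  shows "\<exists>f'. (\<forall>x. ((\<lambda>x. f x * of_real (exp (- \<epsilon> * (norm x)\<^sup>2)))
                  has_derivative (\<lambda>v. f' x v * of_real (exp (- \<epsilon> * (norm x)\<^sup>2)))) (at x))
            \<and> (\<forall>v. tame (\<lambda>x. f' x v))"
proof -
  obtain f' where f': "\<And>x. (f has_derivative f' x) (at x)" "\<And>v. tame (\<lambda>x. f' x v)"
    using tame_has_derivative[OF assms] by blast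
  have "((\<lambda>x. complex_of_real (exp (- \<epsilon> * (norm x)\<^sup>2))) has_derivative
      (\<lambda>v. of_real (exp (- \<epsilon> * (norm x)\<^sup>2) * (- \<epsilon> * (2 * (x \<bullet> v)))))) (at x)" for x :: 'a
    unfolding power2_norm_eq_inner
    by (auto intro!: derivative_eq_intros simp: inner_commute)
  then have "((\<lambda>x. f x * of_real (exp (- \<epsilon> * (norm x)\<^sup>2))) has_derivative
      (\<lambda>v. (f' x v + f x * (of_real (- 2 * \<epsilon>) * of_real (x \<bullet> v))) * of_real (exp (- \<epsilon> * (norm x)\<^sup>2)))) (at x)" for x
    by (rule has_derivative_eq_rhs[OF has_derivative_mult[OF f'(1)]]) (simp add: algebra_simps)
  moreover have "tame (\<lambda>x. f' x v + f x * (of_real (- 2 * \<epsilon>) * of_real (x \<bullet> v)))" for v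
    by (intro tame.intros f' assms)
  ultimately show ?thesis
    by (intro exI[of _ "\<lambda>x v. f' x v + f x * (of_real (- 2 * \<epsilon>) * of_real (x \<bullet> v))"]) blast
qed

lemma schwartz_tame_gaussian:
  assumes f: "tame f" and \<epsilon>: "0 < \<epsilon>"
  shows "schwartz (\<lambda>x. f x * of_real (exp (- \<epsilon> * (norm x)\<^sup>2)))"
proof -
  let ?g = "\<lambda>f x. f x * complex_of_real (exp (- \<epsilon> * (norm x)\<^sup>2))"
  \<comment> \<open>The tame factor is existentially quantified because it changes with each
    differentiation, while the Gaussian stays fixed.\<close>
  have deriv: "\<exists>h. tame h \<and> iterated_deriv vs (?g f) = ?g h" for vs :: "'a list"
  proof (induction vs)
    case Nil
    show ?case using f by auto
  next
    case (Cons v vs)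
    then obtain h where h: "tame h" "iterated_deriv vs (?g f) = ?g h"
      by blast
    obtain h' where h': "\<And>x. (?g h has_derivative (\<lambda>v. h' x v * of_real (exp (- \<epsilon> * (norm x)\<^sup>2)))) (at x)"
      "\<And>v. tame (\<lambda>x. h' x v)"
      using tame_gaussian_has_derivative[OF h(1)] by blast
    have "iterated_deriv (v # vs) (?g f) = ?g (\<lambda>x. h' x v)"
      unfolding iterated_deriv.simps h(2) frechet_derivative_at[OF h'(1), symmetric] ..
    then show ?case
      using h'(2) by blast
  qed
  show ?thesis
    unfolding schwartz_def
  proof (intro ballI conjI allI)
    fix vs :: "'a list" and x :: 'a
    obtain h where h: "tame h" "iterated_deriv vs (?g f) = ?g h"
      using deriv by blast
    show "iterated_deriv vs (?g f) differentiable (at x)"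
      unfolding h(2) differentiable_def using tame_gaussian_has_derivative[OF h(1)] by blast
  next
    fix vs :: "'a list" and N :: nat
    obtain h where h: "tame h" "iterated_deriv vs (?g f) = ?g h"
      using deriv by blast
    obtain C k where C: "\<And>x. norm (h x) \<le> C * (1 + norm x) ^ k"
      using tame_growth[OF h(1)] by blast
    have "C \<ge> 0"
      using C[of 0] order_trans[OF norm_ge_zero] by fastforce
    \<comment> \<open>N powers come from the Schwartz seminorm, k from the growth of the tame
      factor.\<close>
    obtain D where D: "\<And>s. s \<ge> 0 \<Longrightarrow> (1 + s) ^ (N + k) * exp (- \<epsilon> * s\<^sup>2) \<le> D"
      using bounded_power_mult_gaussian[OF \<epsilon>] by blast
    have "norm (norm x ^ N *\<^sub>R ?g h x) \<le> C * D" for x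
    proof -
      have "norm x ^ N * (norm (h x) * exp (- \<epsilon> * (norm x)\<^sup>2))
          \<le> (1 + norm x) ^ N * (C * (1 + norm x) ^ k * exp (- \<epsilon> * (norm x)\<^sup>2))"
        using \<open>C \<ge> 0\<close> by (intro mult_mono power_mono C) auto
      also have "\<dots> = C * ((1 + norm x) ^ (N + k) * exp (- \<epsilon> * (norm x)\<^sup>2))"
        by (simp add: power_add ac_simps)
      also have "\<dots> \<le> C * D"
        using \<open>C \<ge> 0\<close> by (intro mult_left_mono D) auto
      finally show ?thesis
        by (simp add: norm_mult)
    qed
    then show "bounded (range (\<lambda>x. norm x ^ N *\<^sub>R iterated_deriv vs (?g f) x))"
      unfolding h(2) by (intro boundedI) blast
  qed
qed

end

section \<open>Norms on finite measure spaces and conjugate exponents\<close>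

lemma (in finite_measure) nn_integral_norm_le_Lp_norm:
  assumes h [measurable]: "h \<in> borel_measurable M" and p: "1 \<le> p"
  shows "(\<integral>\<^sup>+ x. ennreal (norm (h x)) \<partial>M) \<le> ennreal (measure M (space M) + 1) * Lp_norm p M h"
proof (cases p)
  case top
  have "(\<integral>\<^sup>+ x. ennreal (norm (h x)) \<partial>M) \<le> (\<integral>\<^sup>+ x. esssup M (\<lambda>x. ennreal (norm (h x))) \<partial>M)"
    by (intro nn_integral_mono_AE esssup_AE)
  also have "\<dots> = ennreal (measure M (space M)) * Lp_norm p M h"
    using top by (simp add: Lp_norm_def emeasure_eq_measure mult.commute)
  also have "\<dots> \<le> ennreal (measure M (space M) + 1) * Lp_norm p M h"
    by (intro mult_right_mono ennreal_leI) auto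
  finally show ?thesis .
next
  case (real r)
  then have r: "r \<ge> 1" "p \<noteq> \<infinity>" "enn2real p = r"
    using p by auto
  let ?I = "\<integral>\<^sup>+ x. ennreal (norm (h x) powr r) \<partial>M"
  have Lp: "Lp_norm p M h = ennreal_powr ?I (1 / r)"
    using r by (simp add: Lp_norm_def)
  show ?thesis
  proof (cases ?I)
    \<comment> \<open>The constant is at least 1, so its product with an infinite norm is infinite
      even for the zero measure.\<close>
    case top
    then show ?thesis
      unfolding Lp by (simp add: ennreal_powr_def ennreal_mult_top add_nonneg_pos)
  next
    case (real i)
    have Lp': "Lp_norm p M h = ennreal (i powr (1 / r))"
      unfolding Lp using real by (simp add: ennreal_powr_def)
    show ?thesis
    proof (cases "i = 0")
      case True
      then have "AE x in M. ennreal (norm (h x) powr r) = 0"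
        using real by (subst nn_integral_0_iff_AE[symmetric]) auto
      then have "AE x in M. ennreal (norm (h x)) = 0"
        by eventually_elim simp
      then have "(\<integral>\<^sup>+ x. ennreal (norm (h x)) \<partial>M) = 0"
        by (subst nn_integral_0_iff_AE) auto
      then show ?thesis by simp
    next
      case False
      \<comment> \<open>\<open>N\<close> is the norm of \<open>h\<close>, now positive, so it may be
        divided by.\<close>
      define N where "N = i powr (1 / r)"
      have "i > 0" using False real by simp
      then have N: "N > 0" "N powr r = i"
        using r by (auto simp: N_def powr_powr)
      \<comment> \<open>In place of Holder, the inequality t \<le> 1 + t^r at t = |h x| / N; since
        N^r = i, rescaling gives the coefficient N / i. Integration gives N times the total mass,
        plus N: this is where the constant mass + 1 comes from.\<close>
      have "norm (h x) \<le> N * 1 + N / i * norm (h x) powr r" for x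
      proof -
        have "norm (h x) / N \<le> 1 + (norm (h x) / N) powr r"
        proof (cases "norm (h x) / N \<le> 1")
          case False
          then have "(norm (h x) / N) powr 1 \<le> (norm (h x) / N) powr r"
            using r by (intro powr_mono) auto
          then show ?thesis using N by simp
        qed (simp add: add_increasing2)
        then show ?thesis
          using N by (simp add: powr_divide field_simps)
      qed
      then have "(\<integral>\<^sup>+ x. ennreal (norm (h x)) \<partial>M) \<le> (\<integral>\<^sup>+ x. ennreal N + ennreal (N / i) * ennreal (norm (h x) powr r) \<partial>M)"
        using N \<open>i > 0\<close> by (intro nn_integral_mono) (simp flip: ennreal_mult ennreal_plus)
      also have "\<dots> = ennreal N * emeasure M (space M) + ennreal (N / i) * ?I"
        by (simp add: nn_integral_add nn_integral_cmult)
      also have "\<dots> = ennreal (N * measure M (space M) + N / i * i)"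
        using N \<open>i > 0\<close> real(2) by (simp add: emeasure_eq_measure flip: ennreal_mult ennreal_plus)
      also have "\<dots> = ennreal (measure M (space M) + 1) * Lp_norm p M h"
        unfolding Lp' N_def[symmetric] using N \<open>i > 0\<close>
        by (subst ennreal_mult[symmetric]) (auto simp: algebra_simps)
      finally show ?thesis .
    qed
  qed
qed

lemma conj_exponent_ge_1: "1 \<le> conj_exponent p"
proof -
  have "1 \<le> inverse a" if "a \<le> 1" for a :: ennreal
  proof (cases a)
    case (real r)
    with that show ?thesis
      by (cases "r = 0") (simp_all add: inverse_ennreal one_le_inverse_iff)
  qed (use that top_unique[of "1::ennreal"] in simp)
  then show ?thesis
    by (simp add: conj_exponent_def diff_le_self_ennreal)
qed

lemma conj_exponent_1: "conj_exponent 1 = \<infinity>"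
  by (simp add: conj_exponent_def)

lemma conj_exponent_ennreal:
  assumes "1 < r"
  shows "conj_exponent (ennreal r) = ennreal (r / (r - 1))"
proof -
  have "1 - inverse (ennreal r) = ennreal (1 - 1 / r)"
    using assms by (simp add: inverse_ennreal ennreal_minus inverse_eq_divide flip: ennreal_1)
  also have "inverse \<dots> = ennreal (r / (r - 1))"
    using assms by (subst inverse_ennreal) (auto simp: field_simps)
  finally show ?thesis
    by (simp add: conj_exponent_def)
qed

section \<open>Duality with the transform of the measure\<close>

context bounded_borel_measure
begin

lemma F_measurable [measurable]: "F \<in> borel_measurable borel"
proof -
  have "F differentiable_on UNIV"
    using F_has_derivative unfolding differentiable_on_def differentiable_def by blast
  then show ?thesis
    by (intro borel_measurable_continuous_onI differentiable_imp_continuous_on)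
qed

text \<open>Multiplication formula. The kernel is symmetric in the two variables and of modulus 1,
  so Fubini applies to integrable \<open>g\<close> and finite \<mu>.\<close>

lemma integral_fourier_eq:
  assumes g: "integrable lborel g"
  shows "(LINT \<xi>|\<mu>. fourier lborel g \<xi>) = (LINT x|lborel. g x * F x)"
proof -
  interpret pair_sigma_finite "lborel :: 'a measure" \<mu> ..
  have [measurable]: "g \<in> borel_measurable borel"
    using borel_measurable_integrable[OF g] by simp
  define k where "k x \<xi> = cis (- 2 * pi * (\<xi> \<bullet> x)) * g x" for x \<xi>
  have k_eq: "k x = (\<lambda>\<xi>. cis (- 2 * pi * (x \<bullet> \<xi>)) * g x)" for x
    by (simp add: k_def inner_commute fun_eq_iff)
  have int: "integrable (lborel \<Otimes>\<^sub>M \<mu>) (case_prod k)"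
  proof (rule Fubini_integrable)
    show "case_prod k \<in> borel_measurable (lborel \<Otimes>\<^sub>M \<mu>)"
      unfolding k_def by measurable
    show "integrable lborel (\<lambda>x. LINT \<xi>|\<mu>. norm (case (x, \<xi>) of (x, \<xi>) \<Rightarrow> k x \<xi>))"
      using g by (simp add: k_def norm_mult)
    show "AE x in lborel. integrable \<mu> (\<lambda>\<xi>. case (x, \<xi>) of (x, \<xi>) \<Rightarrow> k x \<xi>)"
      unfolding prod.case k_eq by (intro AE_I2 weight_integrable weight_mult weight_cis weight_const)
  qed
  have "(LINT \<xi>|\<mu>. fourier lborel g \<xi>) = (LINT \<xi>|\<mu>. LINT x|lborel. k x \<xi>)"
    by (simp add: fourier_cis k_def)
  also have "\<dots> = (LINT x|lborel. LINT \<xi>|\<mu>. k x \<xi>)"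
    by (rule Fubini_integral[OF int])
  also have "\<dots> = (LINT x|lborel. g x * F x)"
    unfolding k_def fourier_cis by (simp add: inner_commute mult.commute)
  finally show ?thesis .
qed

lemma fourier_lborel_measurable [measurable]:
  assumes [measurable]: "g \<in> borel_measurable borel"
  shows "fourier lborel g \<in> borel_measurable borel"
proof -
  have "fourier lborel g = (\<lambda>\<xi>. LINT x|lborel. cis (- 2 * pi * (\<xi> \<bullet> x)) * g x)"
    by (simp add: fourier_cis fun_eq_iff)
  then show ?thesis by simp
qed

lemma weight_fourier_lborel:
  assumes [measurable]: "g \<in> borel_measurable borel"
  shows "weight (fourier lborel g)"
proof (rule weight_bounded)
  fix \<xi>
  have "norm (fourier lborel g \<xi>) \<le> (LINT x|lborel. norm (cis (- 2 * pi * (\<xi> \<bullet> x)) * g x))"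
    \<comment> \<open>For non-integrable \<open>g\<close> both integrals have the default value 0,
      and the bound still holds.\<close>
    unfolding fourier_cis by (rule integral_norm_bound)
  then show "norm (fourier lborel g \<xi>) \<le> (LINT x|lborel. norm (g x))"
    by (simp add: norm_mult)
qed measurable

text \<open>Testing the estimate against the constant density 1: on a finite measure the integral of
  the transform of \<open>g\<close> is controlled by its norm with exponent p'. From here on p has
  disappeared and only q matters.\<close>

lemma restriction_estimate_dual:
  assumes est: "restriction_estimate \<mu> p q" and p: "1 \<le> p"
  shows "\<exists>K\<ge>0. \<forall>g. schwartz g \<longrightarrow> integrable lborel g \<longrightarrow>
    ennreal (norm (LINT x|lborel. g x * F x)) \<le> ennreal K * Lp_norm (conj_exponent q) lborel g"
proof -
  obtain C where C: "C > 0" "\<And>g. schwartz g \<Longrightarrow>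
      Lp_norm (conj_exponent p) \<mu> (fourier lborel g) \<le> ennreal C * Lp_norm (conj_exponent q) lborel g"
    using est by (auto simp: restriction_estimate_def)
  have "ennreal (norm (LINT x|lborel. g x * F x))
      \<le> ennreal ((measure \<mu> UNIV + 1) * C) * Lp_norm (conj_exponent q) lborel g"
    if g: "schwartz g" "integrable lborel g" for g
  proof -
    have [measurable]: "g \<in> borel_measurable borel"
      using borel_measurable_integrable[OF g(2)] by simp
    have "ennreal (norm (LINT x|lborel. g x * F x)) \<le> (\<integral>\<^sup>+ \<xi>. ennreal (norm (fourier lborel g \<xi>)) \<partial>\<mu>)"
      unfolding integral_fourier_eq[OF g(2), symmetric] by (intro integral_norm_bound_ennreal weight_integrable weight_fourier_lborel) measurable
    also have "\<dots> \<le> ennreal (measure \<mu> UNIV + 1) * Lp_norm (conj_exponent p) \<mu> (fourier lborel g)"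
      using nn_integral_norm_le_Lp_norm[of "fourier lborel g" "conj_exponent p"] conj_exponent_ge_1
      by simp
    also have "\<dots> \<le> ennreal (measure \<mu> UNIV + 1) * (ennreal C * Lp_norm (conj_exponent q) lborel g)"
      using g by (intro mult_left_mono C) auto
    finally show ?thesis
      using C by (simp add: ennreal_mult mult.assoc)
  qed
  then show ?thesis
    using C by (intro exI[of _ "(measure \<mu> UNIV + 1) * C"]) auto
qed

end

section \<open>Regularized extremal functions for the duality of exponents\<close>

lemma power2_add_powr_bound:
  fixes t \<delta> a :: real
  assumes "0 \<le> t" "0 < \<delta>"
  shows "t * (t\<^sup>2 + \<delta>) powr a \<le> (t\<^sup>2 + \<delta>) powr (a + 1 / 2)"
proof -
  have pos: "t\<^sup>2 + \<delta> > 0"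
    using assms by (simp add: add_nonneg_pos)
  have "t \<le> sqrt (t\<^sup>2 + \<delta>)"
    using assms by (intro real_le_rsqrt) simp
  also have "\<dots> = (t\<^sup>2 + \<delta>) powr (1 / 2)"
    using pos by (simp add: powr_half_sqrt)
  finally have "t * (t\<^sup>2 + \<delta>) powr a \<le> (t\<^sup>2 + \<delta>) powr (1 / 2) * (t\<^sup>2 + \<delta>) powr a"
    by (intro mult_right_mono) auto
  then show ?thesis
    by (simp add: powr_add mult.commute)
qed

lemma tendsto_regularized_power:
  fixes t r :: real
  assumes "0 \<le> t"
  shows "(\<lambda>n. t * (t\<^sup>2 + inverse (real (Suc n))) powr ((r - 2) / 2)) \<longlonglongrightarrow> t powr (r - 1)"
proof (cases "t = 0")
  case False
  then have t: "t > 0" using assms by simp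
  have "(\<lambda>n. t * (t\<^sup>2 + inverse (real (Suc n))) powr ((r - 2) / 2)) \<longlonglongrightarrow> t * (t\<^sup>2 + 0) powr ((r - 2) / 2)"
    using t by (intro tendsto_intros LIMSEQ_inverse_real_of_nat) auto
  also have "t * (t\<^sup>2 + 0) powr ((r - 2) / 2) = t powr 1 * (t powr 2) powr ((r - 2) / 2)"
    using t by simp
  also have "\<dots> = t powr (1 + 2 * ((r - 2) / 2))"
    by (simp only: powr_powr powr_add)
  also have "1 + 2 * ((r - 2) / 2) = r - 1"
    by (simp add: field_simps)
  finally show ?thesis .
\<comment> \<open>At t = 0 both sides vanish: the factor t kills the sequence, and
  \<open>0 powr (r - 1)\<close> is 0 for every r, including r = 1.\<close>
qed simp

text \<open>The absorption step. As B \<le> A, the hypothesis bounds A by K times A^(1 - 1/r); A is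
  a finite real number, so for A > 0 this power may be divided out.\<close>

lemma le_powr_of_le_mult_powr:
  fixes A B K r :: real
  assumes "0 \<le> A" "0 \<le> B" "B \<le> A" "0 \<le> K" "1 \<le> r"
    and le: "A \<le> K * B powr (1 - 1 / r)"
  shows "A \<le> K powr r"
proof (cases "A = 0")
  case False
  then have "A > 0" using assms by simp
  have "B powr (1 - 1 / r) \<le> A powr (1 - 1 / r)"
    using assms by (intro powr_mono2) auto
  then have "A \<le> K * A powr (1 - 1 / r)"
    using le mult_left_mono[OF _ \<open>0 \<le> K\<close>] by (meson order_trans)
  also have "\<dots> = K * A / A powr (1 / r)"
    using \<open>A > 0\<close> by (simp add: powr_diff)
  finally have "A powr (1 / r) \<le> K"
    using \<open>A > 0\<close> by (simp add: field_simps)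
  then have "(A powr (1 / r)) powr r \<le> K powr r"
    using assms by (intro powr_mono2) auto
  then show ?thesis
    using assms \<open>A > 0\<close> by (simp add: powr_powr)
qed simp

context bounded_borel_measure
begin

text \<open>Modulus of the test function without its Gaussian. As \<delta> tends to 0 it tends to
  |F|^(r - 1), the equality case of Holder for the exponent r.\<close>

definition profile :: "real \<Rightarrow> real \<Rightarrow> 'a \<Rightarrow> real" where
  "profile r \<delta> x = norm (F x) * ((norm (F x))\<^sup>2 + \<delta>) powr ((r - 2) / 2)"

definition test_fun :: "real \<Rightarrow> real \<Rightarrow> real \<Rightarrow> 'a \<Rightarrow> complex" where
  "test_fun r \<delta> \<epsilon> x =
     cnj (F x) * of_real (((norm (F x))\<^sup>2 + \<delta>) powr ((r - 2) / 2)) * of_real (exp (- \<epsilon> * (norm x)\<^sup>2))"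

lemma profile_measurable [measurable]: "profile r \<delta> \<in> borel_measurable borel"
  unfolding profile_def by measurable

lemma test_fun_measurable [measurable]: "test_fun r \<delta> \<epsilon> \<in> borel_measurable borel"
proof -
  have [measurable]: "cnj \<in> borel_measurable borel" "complex_of_real \<in> borel_measurable borel"
    by (intro borel_measurable_continuous_onI continuous_intros)+
  show ?thesis
    unfolding test_fun_def by measurable
qed

lemma profile_nonneg: "0 \<le> profile r \<delta> x"
  by (simp add: profile_def)

lemma norm_test_fun: "norm (test_fun r \<delta> \<epsilon> x) = profile r \<delta> x * exp (- \<epsilon> * (norm x)\<^sup>2)"
  by (simp add: test_fun_def profile_def norm_mult)

text \<open>The conjugate in the test function makes the pairing with \<open>F\<close> a nonnegative
  real, so its integral has no cancellation.\<close>

lemma test_fun_mult_F: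
  "test_fun r \<delta> \<epsilon> x * F x = of_real (norm (F x) * profile r \<delta> x * exp (- \<epsilon> * (norm x)\<^sup>2))"
proof -
  have "test_fun r \<delta> \<epsilon> x * F x = (F x * cnj (F x)) *
      of_real (((norm (F x))\<^sup>2 + \<delta>) powr ((r - 2) / 2) * exp (- \<epsilon> * (norm x)\<^sup>2))"
    unfolding test_fun_def of_real_mult by (simp only: ac_simps)
  then show ?thesis
    unfolding complex_norm_square[symmetric] of_real_mult[symmetric] profile_def power2_eq_square
    by (simp only: ac_simps)
qed

lemma schwartz_test_fun:
  assumes "0 < \<delta>" "0 < \<epsilon>"
  shows "schwartz (test_fun r \<delta> \<epsilon>)"
  unfolding test_fun_def using assms
  by (intro schwartz_tame_gaussian tame_mult[OF tame_cnj[OF tame_fourier[OF weight_const]] tame_powr])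

text \<open>For r < 2 the power alone blows up at zeros of \<open>F\<close> as \<delta> tends to 0.
  The factor |F| absorbs half a power, leaving the exponent (r - 1) / 2 \<ge> 0 and hence a bound
  uniform in \<delta>.\<close>

lemma profile_le:
  assumes "1 \<le> r" "0 < \<delta>" "\<delta> \<le> 1"
  shows "profile r \<delta> x \<le> ((measure \<mu> UNIV)\<^sup>2 + 1) powr ((r - 1) / 2)"
proof -
  have "profile r \<delta> x \<le> ((norm (F x))\<^sup>2 + \<delta>) powr ((r - 2) / 2 + 1 / 2)"
    unfolding profile_def using assms by (intro power2_add_powr_bound) auto
  also have "(r - 2) / 2 + 1 / 2 = (r - 1) / 2"
    by (simp add: field_simps)
  also have "((norm (F x))\<^sup>2 + \<delta>) powr ((r - 1) / 2) \<le> ((measure \<mu> UNIV)\<^sup>2 + 1) powr ((r - 1) / 2)"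
    using assms by (intro powr_mono2 add_mono power_mono norm_F_le) auto
  finally show ?thesis .
qed

lemma profile_tendsto:
  "(\<lambda>n. profile r (inverse (real (Suc n))) x) \<longlonglongrightarrow> norm (F x) powr (r - 1)"
  unfolding profile_def by (rule tendsto_regularized_power) simp

lemma integrable_test_fun:
  assumes "1 \<le> r" "0 < \<delta>" "\<delta> \<le> 1" "0 < \<epsilon>"
  shows "integrable lborel (test_fun r \<delta> \<epsilon>)"
proof (rule Bochner_Integration.integrable_bound)
  show "integrable lborel (\<lambda>x::'a. ((measure \<mu> UNIV)\<^sup>2 + 1) powr ((r - 1) / 2) * exp (- \<epsilon> * (norm x)\<^sup>2))"
    using assms by (intro integrable_mult_right integrable_gaussian_euclidean)
qed (auto simp: norm_test_fun intro!: AE_I2 mult_right_mono profile_le assms)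

text \<open>Passage to the limit in \<delta> with \<epsilon> fixed; the Gaussian provides the
  integrable majorants. What matters is that the bound \<open>K powr r\<close> does not involve
  \<epsilon>.\<close>

lemma gaussian_integral_bound:
  assumes K: "0 \<le> K" "\<And>g. schwartz g \<Longrightarrow> integrable lborel g \<Longrightarrow>
      ennreal (norm (LINT x|lborel. g x * F x)) \<le> ennreal K * Lp_norm (conj_exponent (ennreal r)) lborel g"
    and r: "1 \<le> r" and \<epsilon>: "0 < \<epsilon>"
  shows "integrable lborel (\<lambda>x. norm (F x) powr r * exp (- \<epsilon> * (norm x)\<^sup>2))"
    and "(LINT x|lborel. norm (F x) powr r * exp (- \<epsilon> * (norm x)\<^sup>2)) \<le> K powr r"
proof -
  define \<delta> where "\<delta> n = inverse (real (Suc n))" for n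
  have \<delta>: "0 < \<delta> n" "\<delta> n \<le> 1" for n
    by (auto simp: \<delta>_def field_simps)
  define P where "P = ((measure \<mu> UNIV)\<^sup>2 + 1) powr ((r - 1) / 2)"
  have P: "profile r (\<delta> n) x \<le> P" for n x
    unfolding P_def using r \<delta> by (rule profile_le)
  define gs where "gs x = exp (- \<epsilon> * (norm x)\<^sup>2)" for x :: 'a
  have gs: "0 < gs x" "gs x \<le> 1" for x
    using \<epsilon> by (auto simp: gs_def)
  have gs_int: "integrable lborel gs"
    unfolding gs_def using \<epsilon> by (rule integrable_gaussian_euclidean)
  have [measurable]: "gs \<in> borel_measurable borel"
    unfolding gs_def by measurable
  define M where "M = measure \<mu> UNIV"
  define A where "A = (LINT x|lborel. norm (F x) powr r * gs x)"
  \<comment> \<open>The pairing of the test function with \<open>F\<close>, to which the dual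
    estimate applies; its limit is \<open>A\<close>.\<close>
  define A' where "A' n = (LINT x|lborel. norm (F x) * profile r (\<delta> n) x * gs x)" for n
  have dom: "norm (F x) * profile r (\<delta> n) x * gs x \<le> M * P * gs x" for n x
    unfolding M_def using gs[of x] profile_nonneg
    by (intro mult_right_mono mult_mono P norm_F_le) auto
  have lim: "(\<lambda>n. norm (F x) * profile r (\<delta> n) x * gs x) \<longlonglongrightarrow> norm (F x) powr r * gs x" for x
  proof -
    have "norm (F x) powr r = norm (F x) * norm (F x) powr (r - 1)"
      by (cases "F x = 0") (auto simp: powr_diff)
    then show ?thesis
      unfolding \<delta>_def by (simp only:) (intro tendsto_intros profile_tendsto)
  qed
  have dct: "integrable lborel (\<lambda>x. norm (F x) powr r * gs x)" "A' \<longlonglongrightarrow> A"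
  proof -
    have w: "integrable lborel (\<lambda>x. M * P * gs x)"
      by (intro integrable_mult_right gs_int)
    have d: "AE x in lborel. norm (norm (F x) * profile r (\<delta> n) x * gs x) \<le> M * P * gs x" for n
      using dom gs by (auto simp: profile_nonneg abs_mult less_imp_le)
    show "integrable lborel (\<lambda>x. norm (F x) powr r * gs x)"
      by (rule integrable_dominated_convergence[where s = "\<lambda>n x. norm (F x) * profile r (\<delta> n) x * gs x" and w = "\<lambda>x. M * P * gs x"])
        (use w d lim in auto)
    show "A' \<longlonglongrightarrow> A"
      unfolding A'_def A_def
      by (rule integral_dominated_convergence[where w = "\<lambda>x. M * P * gs x"])
        (use w d lim in auto)
  qed
  have A_nonneg: "0 \<le> A"
    unfolding A_def using gs by (intro Bochner_Integration.integral_nonneg) (simp add: less_imp_le)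
  have A'_nonneg: "0 \<le> A' n" for n
    unfolding A'_def using gs by (intro Bochner_Integration.integral_nonneg) (simp add: less_imp_le profile_nonneg)
  have A'_le: "ennreal (A' n) \<le> ennreal K * Lp_norm (conj_exponent (ennreal r)) lborel (test_fun r (\<delta> n) \<epsilon>)" for n
  proof -
    have "(LINT x|lborel. test_fun r (\<delta> n) \<epsilon> x * F x) = of_real (A' n)"
      unfolding test_fun_mult_F A'_def gs_def by (rule integral_complex_of_real)
    then show ?thesis
      using K(2)[OF schwartz_test_fun integrable_test_fun] r \<delta> \<epsilon> A'_nonneg[of n] by (metis abs_of_nonneg norm_of_real)
  qed
  have "A \<le> K powr r"
  proof (cases "r = 1")
    \<comment> \<open>The conjugate exponent is infinite, so the sup norm is needed. Here
      \<open>P\<close> has exponent 0 and equals 1, so all test functions are bounded by 1.\<close>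
    case True
    have "A' n \<le> K" for n
    proof -
      have "norm (test_fun r (\<delta> n) \<epsilon> x) \<le> 1" for x
      proof -
        have "P = 1"
          by (auto simp: P_def True add_nonneg_eq_0_iff)
        then show ?thesis
          using P[of n x] gs[of x] profile_nonneg unfolding norm_test_fun gs_def[symmetric]
          by (intro mult_le_one) auto
      qed
      then have "Lp_norm \<infinity> lborel (test_fun r (\<delta> n) \<epsilon>) \<le> 1"
        unfolding Lp_norm_def by (auto intro!: esssup_I)
      then have "ennreal K * Lp_norm \<infinity> lborel (test_fun r (\<delta> n) \<epsilon>) \<le> ennreal K * 1"
        by (intro mult_left_mono) auto
      then have "ennreal (A' n) \<le> ennreal K * 1"
        using A'_le[of n] unfolding True ennreal_1 conj_exponent_1 by (rule order_trans[rotated])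
      then show ?thesis
        using K by simp
    qed
    then have "A \<le> K"
      using dct(2) by (intro LIMSEQ_le_const2) auto
    then show ?thesis
      using K True by (cases "K = 0") auto
  next
    case False
    then have r1: "1 < r" using r by simp
    \<comment> \<open>The conjugate exponent of r; (r - 1) s = r turns the limiting profile to the
      power s into |F|^r.\<close>
    define s where "s = r / (r - 1)"
    have s: "s > 1" "(r - 1) * s = r" "1 / s = 1 - 1 / r"
      using r1 by (auto simp: s_def field_simps)
    define B where "B = (LINT x|lborel. norm (F x) powr r * gs x powr s)"
    define B' where "B' n = (LINT x|lborel. (profile r (\<delta> n) x * gs x) powr s)" for n
    \<comment> \<open>A number in (0, 1] decreases when raised to a power s > 1. This gives B \<le>
      A, which lets the two different Gaussian weights be compared.\<close>
    have gs_powr: "gs x powr s \<le> gs x" for x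
      using powr_mono'[of 1 s "gs x"] gs[of x] s by simp
    have dom2: "(profile r (\<delta> n) x * gs x) powr s \<le> P powr s * gs x" for n x
    proof -
      have "(profile r (\<delta> n) x * gs x) powr s = profile r (\<delta> n) x powr s * gs x powr s"
        using gs[of x] profile_nonneg by (simp add: powr_mult)
      also have "\<dots> \<le> P powr s * gs x"
        using s gs_powr P profile_nonneg by (intro mult_mono powr_mono2) auto
      finally show ?thesis .
    qed
    have lim2: "(\<lambda>n. (profile r (\<delta> n) x * gs x) powr s) \<longlonglongrightarrow> norm (F x) powr r * gs x powr s" for x
    proof -
      \<comment> \<open>The limit of the base may be 0, so continuity of the power relies on s > 0
        and nonnegativity.\<close>
      have "(\<lambda>n. (profile r (\<delta> n) x * gs x) powr s) \<longlonglongrightarrow> (norm (F x) powr (r - 1) * gs x) powr s"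
        using s gs[of x] unfolding \<delta>_def
        by (intro tendsto_powr2 tendsto_intros profile_tendsto) (auto simp: profile_nonneg)
      then show ?thesis
        using s gs[of x] by (simp add: powr_mult powr_powr)
    qed
    have w2: "integrable lborel (\<lambda>x. P powr s * gs x)"
      by (intro integrable_mult_right gs_int)
    have int2: "integrable lborel (\<lambda>x. (profile r (\<delta> n) x * gs x) powr s)" for n
      by (rule Bochner_Integration.integrable_bound[OF w2]) (use dom2 in \<open>auto intro!: AE_I2 order_trans[OF dom2]\<close>)
    have d2: "AE x in lborel. norm ((profile r (\<delta> n) x * gs x) powr s) \<le> P powr s * gs x" for n
      using dom2 by simp
    have lim_int2: "integrable lborel (\<lambda>x. norm (F x) powr r * gs x powr s)"
      by (rule integrable_dominated_convergence[where s = "\<lambda>n x. (profile r (\<delta> n) x * gs x) powr s" and w = "\<lambda>x. P powr s * gs x"])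
        (use w2 d2 lim2 in auto)
    have B': "B' \<longlonglongrightarrow> B"
      unfolding B'_def B_def
      by (rule integral_dominated_convergence[where w = "\<lambda>x. P powr s * gs x"])
        (use w2 d2 lim2 in auto)
    have B'_nonneg: "0 \<le> B' n" for n
      unfolding B'_def by (intro Bochner_Integration.integral_nonneg) simp
    have B_nonneg: "0 \<le> B"
      unfolding B_def by (intro Bochner_Integration.integral_nonneg) simp
    have B_le: "B \<le> A"
      unfolding A_def B_def using gs_powr by (intro integral_mono lim_int2 dct(1) mult_left_mono) auto
    have "A' n \<le> K * B' n powr (1 / s)" for n
    proof -
      have "Lp_norm (conj_exponent (ennreal r)) lborel (test_fun r (\<delta> n) \<epsilon>)
          = ennreal_powr (\<integral>\<^sup>+ x. ennreal ((profile r (\<delta> n) x * gs x) powr s) \<partial>lborel) (1 / s)"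
        using s by (simp add: conj_exponent_ennreal[OF r1] Lp_norm_def norm_test_fun gs_def flip: s_def)
      also have "(\<integral>\<^sup>+ x. ennreal ((profile r (\<delta> n) x * gs x) powr s) \<partial>lborel) = ennreal (B' n)"
        unfolding B'_def by (intro nn_integral_eq_integral int2) simp
      also have "ennreal_powr (ennreal (B' n)) (1 / s) = ennreal (B' n powr (1 / s))"
        using B'_nonneg by (simp add: ennreal_powr_def)
      finally have "ennreal (A' n) \<le> ennreal (K * B' n powr (1 / s))"
        using A'_le[of n] K by (simp add: ennreal_mult)
      then show ?thesis
        using K by simp
    qed
    moreover have "(\<lambda>n. K * B' n powr (1 / s)) \<longlonglongrightarrow> K * B powr (1 / s)"
      using s r1 B' B'_nonneg by (intro tendsto_powr2 tendsto_intros) auto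
    ultimately have "A \<le> K * B powr (1 / s)"
      using dct(2) by (intro LIMSEQ_le[of A' _ "\<lambda>n. K * B' n powr (1 / s)"]) auto
    then show ?thesis
      using le_powr_of_le_mult_powr[OF A_nonneg B_nonneg B_le K(1) r] s by simp
  qed
  then show "(LINT x|lborel. norm (F x) powr r * exp (- \<epsilon> * (norm x)\<^sup>2)) \<le> K powr r"
    by (simp add: A_def gs_def)
  show "integrable lborel (\<lambda>x. norm (F x) powr r * exp (- \<epsilon> * (norm x)\<^sup>2))"
    using dct(1) by (simp add: gs_def)
qed

text \<open>Fatou as \<epsilon> tends to 0: the Gaussian-weighted integrals are bounded
  independently of \<epsilon> and their integrands converge pointwise.\<close>

lemma restriction_estimate_imp_finite:
  assumes est: "restriction_estimate \<mu> p (ennreal r)" and p: "1 \<le> p" and r: "1 \<le> r"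
  shows "(\<integral>\<^sup>+ x. ennreal (norm (F x) powr r) \<partial>lborel) < \<infinity>"
proof -
  obtain K where K: "0 \<le> K" "\<And>g. schwartz g \<Longrightarrow> integrable lborel g \<Longrightarrow>
      ennreal (norm (LINT x|lborel. g x * F x)) \<le> ennreal K * Lp_norm (conj_exponent (ennreal r)) lborel g"
    using restriction_estimate_dual[OF est p] by blast
  define \<epsilon> where "\<epsilon> n = inverse (real (Suc n))" for n
  define u where "u n x = norm (F x) powr r * exp (- \<epsilon> n * (norm x)\<^sup>2)" for n x
  have [measurable]: "u n \<in> borel_measurable borel" for n
    unfolding u_def by measurable
  have u: "integrable lborel (u n)" "(LINT x|lborel. u n x) \<le> K powr r" for n
    unfolding u_def by (intro gaussian_integral_bound[OF K r]; simp add: \<epsilon>_def)+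
  have u_nonneg: "0 \<le> u n x" for n x
    by (simp add: u_def)
  have u_le: "(\<integral>\<^sup>+ x. ennreal (u n x) \<partial>lborel) \<le> ennreal (K powr r)" for n
    unfolding nn_integral_eq_integral[OF u(1) AE_I2[OF u_nonneg]] by (intro ennreal_leI u(2))
  have "liminf (\<lambda>n. ennreal (u n x)) = ennreal (norm (F x) powr r)" for x
  proof (rule lim_imp_Liminf)
    have "(\<lambda>n. u n x) \<longlonglongrightarrow> norm (F x) powr r * exp (- 0 * (norm x)\<^sup>2)"
      unfolding u_def \<epsilon>_def by (intro tendsto_intros LIMSEQ_inverse_real_of_nat)
    then show "(\<lambda>n. ennreal (u n x)) \<longlonglongrightarrow> ennreal (norm (F x) powr r)"
      by (intro tendsto_ennrealI) simp
  qed simp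
  then have "(\<integral>\<^sup>+ x. ennreal (norm (F x) powr r) \<partial>lborel) \<le> liminf (\<lambda>n. \<integral>\<^sup>+ x. ennreal (u n x) \<partial>lborel)"
    using nn_integral_liminf[of "\<lambda>n x. ennreal (u n x)" lborel] by simp
  also have "\<dots> \<le> ennreal (K powr r)"
    using u_le by (intro Liminf_le) auto
  finally show ?thesis
    by (simp add: le_less_trans)
qed

end

section \<open>Energies, the Fourier spectrum and the norm of the constant 1\<close>

lemma energy_J_critical:
  fixes \<mu> :: "'a::euclidean_space measure"
  assumes "0 < \<theta>"
  shows "energy_J (real DIM('a) * \<theta>) \<theta> \<mu> = \<infinity> \<longleftrightarrow>
    (\<integral>\<^sup>+ \<xi>. ennreal (norm (fourier \<mu> (\<lambda>_. 1) \<xi>) powr (2 / \<theta>)) \<partial>lborel) = \<infinity>"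
proof -
  have "(\<integral>\<^sup>+ \<xi>. ennreal (norm (fourier \<mu> (\<lambda>_. 1) \<xi>) powr (2 / \<theta>)
      * norm \<xi> powr (real DIM('a) * \<theta> / \<theta> - real DIM('a))) \<partial>lborel)
    = (\<integral>\<^sup>+ \<xi>. ennreal (norm (fourier \<mu> (\<lambda>_. 1) \<xi>) powr (2 / \<theta>)) \<partial>lborel)"
  proof (rule nn_integral_cong_AE)
    show "AE \<xi> in lborel. ennreal (norm (fourier \<mu> (\<lambda>_. 1) \<xi>) powr (2 / \<theta>)
        * norm \<xi> powr (real DIM('a) * \<theta> / \<theta> - real DIM('a)))
      = ennreal (norm (fourier \<mu> (\<lambda>_. 1) \<xi>) powr (2 / \<theta>))"
      \<comment> \<open>At the critical s the weight has exponent 0, hence is 1 off the origin. At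
        the origin \<open>0 powr 0\<close> is 0, so equality holds only almost everywhere.\<close>
      using AE_lborel_singleton[of "0::'a"] by eventually_elim (use assms in simp)
  qed
  then show ?thesis
    unfolding energy_J_def by (simp only: ennreal_powr_def) simp
qed

lemma energy_J_eq_top_of_spectrum_less:
  assumes "fourier_spectrum \<theta> \<mu> < ereal s"
  shows "energy_J s \<theta> \<mu> = \<infinity>"
proof (rule ccontr)
  assume "energy_J s \<theta> \<mu> \<noteq> \<infinity>"
  then have s: "s \<in> {s. energy_J s \<theta> \<mu> < \<infinity>}"
    by (simp add: less_top)
  then have "ereal s \<le> Sup (ereal ` {s. energy_J s \<theta> \<mu> < \<infinity>})"
    by (intro Sup_upper imageI)
  \<comment> \<open>The set contains s, so the default value 0 for the empty set does not
    apply.\<close>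
  also have "\<dots> = fourier_spectrum \<theta> \<mu>"
    using s unfolding fourier_spectrum_def by (subst if_not_P) auto
  finally show False
    using assms by simp
qed

lemma Lp_norm_one:
  assumes finite: "finite_measure M" and nonzero: "emeasure M (space M) \<noteq> 0" and p: "1 \<le> p"
  shows "Lp_norm p M (\<lambda>_. 1) = ennreal_powr (emeasure M (space M)) (enn2real (inverse p))"
    and "Lp_norm p M (\<lambda>_. 1) < \<infinity>"
proof -
  interpret finite_measure M by fact
  show "Lp_norm p M (\<lambda>_. 1) = ennreal_powr (emeasure M (space M)) (enn2real (inverse p))"
  proof (cases p)
    case top
    then show ?thesis
      \<comment> \<open>With \<open>inverse p\<close> equal to 0, positive mass ensures that the
        power is 1 rather than \<open>0 powr 0 = 0\<close>.\<close>
      using nonzero by (simp add: Lp_norm_def esssup_const ennreal_powr_def emeasure_eq_measure)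
  next
    case (real r)
    with p have "r \<ge> 1" by simp
    with real show ?thesis
      by (simp add: Lp_norm_def inverse_ennreal inverse_eq_divide)
  qed
  then show "Lp_norm p M (\<lambda>_. 1) < \<infinity>"
    by (simp add: ennreal_powr_def)
qed

section \<open>Failure of the restriction estimate\<close>

context bounded_borel_measure
begin

text \<open>\<open>F\<close> is bounded by the total mass, so integrability of |F|^r passes to every
  larger exponent t. Divergence at t thus excludes the estimate for all smaller exponents as
  well.\<close>

lemma not_restriction_estimate:
  assumes inf: "(\<integral>\<^sup>+ x. ennreal (norm (F x) powr t) \<partial>lborel) = \<infinity>"
    and r: "1 \<le> r" "r \<le> t" and p: "1 \<le> p"
  shows "\<not> restriction_estimate \<mu> p (ennreal r)"
proof
  assume "restriction_estimate \<mu> p (ennreal r)"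
  then have fin: "(\<integral>\<^sup>+ x. ennreal (norm (F x) powr r) \<partial>lborel) < \<infinity>"
    using restriction_estimate_imp_finite p r by blast
  have "norm (F x) powr t \<le> measure \<mu> UNIV powr (t - r) * norm (F x) powr r" for x
  proof -
    have "norm (F x) powr t = norm (F x) powr (t - r) * norm (F x) powr r"
      by (simp flip: powr_add)
    also have "\<dots> \<le> measure \<mu> UNIV powr (t - r) * norm (F x) powr r"
      using r by (intro mult_right_mono powr_mono2 norm_F_le) auto
    finally show ?thesis .
  qed
  then have "(\<integral>\<^sup>+ x. ennreal (norm (F x) powr t) \<partial>lborel)
      \<le> (\<integral>\<^sup>+ x. ennreal (measure \<mu> UNIV powr (t - r)) * ennreal (norm (F x) powr r) \<partial>lborel)"
    by (intro nn_integral_mono) (simp flip: ennreal_mult)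
  also have "\<dots> = ennreal (measure \<mu> UNIV powr (t - r)) * (\<integral>\<^sup>+ x. ennreal (norm (F x) powr r) \<partial>lborel)"
    by (intro nn_integral_cmult) measurable
  also have "\<dots> < \<infinity>"
    using fin by (simp add: ennreal_mult_less_top)
  finally show False
    using inf by simp
qed

end

theorem theorem3p6:
  fixes \<mu> :: "'a::euclidean_space measure"
  assumes borel: "sets \<mu> = sets borel"
    and finite: "finite_measure \<mu>"
    and nonzero: "emeasure \<mu> UNIV \<noteq> 0"
    and compact_support: "compact (measure_support \<mu>)"
  shows "(\<forall>(q::ennreal) (\<theta>::real).
            0 < \<theta> \<and> \<theta> \<le> 1 \<and> q = ennreal (2 / \<theta>)
              \<and> energy_J (real DIM('a) * \<theta>) \<theta> \<mu> = \<infinity> \<longrightarrow>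
            (\<forall>p::ennreal. 1 \<le> p \<longrightarrow>
               Lp_norm q lborel (fourier \<mu> (\<lambda>_. 1)) = \<infinity>
               \<and> Lp_norm p \<mu> (\<lambda>_. 1) < \<infinity>
               \<and> Lp_norm p \<mu> (\<lambda>_. 1) = ennreal_powr (emeasure \<mu> UNIV) (enn2real (inverse p))
               \<and> \<not> restriction_estimate \<mu> p q))
       \<and> (\<forall>q::ennreal.
            1 \<le> q
              \<and> q < Sup {ennreal (2 / \<theta>) | \<theta>::real.
                          0 < \<theta> \<and> \<theta> \<le> 1
                            \<and> fourier_spectrum \<theta> \<mu> < ereal (real DIM('a) * \<theta>)} \<longrightarrow>
            (\<forall>p::ennreal. 1 \<le> p \<longrightarrow> \<not> restriction_estimate \<mu> p q))"
proof -
  obtain R where R: "\<And>x. x \<in> measure_support \<mu> \<Longrightarrow> norm x \<le> R"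
    using compact_imp_bounded[OF compact_support] by (auto simp: bounded_iff)
  have "AE x in \<mu>. norm x \<le> R"
    using AE_in_measure_support[OF borel] by eventually_elim (rule R)
  then interpret bounded_borel_measure \<mu> R
    using borel finite by (simp add: bounded_borel_measure_def bounded_borel_measure_axioms_def)
  show ?thesis
  proof (intro conjI allI impI; (elim conjE)?)
    fix q p :: ennreal and \<theta> :: real
    assume \<theta>: "0 < \<theta>" "\<theta> \<le> 1" "q = ennreal (2 / \<theta>)" "energy_J (real DIM('a) * \<theta>) \<theta> \<mu> = \<infinity>"
      and p: "1 \<le> p"
    have inf: "(\<integral>\<^sup>+ \<xi>. ennreal (norm (F \<xi>) powr (2 / \<theta>)) \<partial>lborel) = \<infinity>"
      using \<theta> energy_J_critical by blast
    then show "Lp_norm q lborel F = \<infinity>"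
      using \<theta> by (simp add: Lp_norm_def ennreal_powr_def)
    show "Lp_norm p \<mu> (\<lambda>_. 1) < \<infinity>"
      "Lp_norm p \<mu> (\<lambda>_. 1) = ennreal_powr (emeasure \<mu> UNIV) (enn2real (inverse p))"
      using Lp_norm_one[OF finite _ p] nonzero by simp_all
    show "\<not> restriction_estimate \<mu> p q"
      \<comment> \<open>Both exponents are taken to be 2 / \<theta>, which is at least 1 because
        \<theta> \<le> 1.\<close>
      unfolding \<theta>(3) using \<theta> by (intro not_restriction_estimate[OF inf _ _ p]) auto
  next
    fix q p :: ennreal
    assume q: "1 \<le> q" and less: "q < Sup {ennreal (2 / \<theta>) | \<theta>::real. 0 < \<theta> \<and> \<theta> \<le> 1
        \<and> fourier_spectrum \<theta> \<mu> < ereal (real DIM('a) * \<theta>)}" and p: "1 \<le> p"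
    \<comment> \<open>Some admissible \<theta> already has 2 / \<theta> above q. Its spectrum lies
      below the critical value, so the critical energy diverges; moreover q is finite, being below a
      real number.\<close>
    obtain \<theta> where \<theta>: "0 < \<theta>" "fourier_spectrum \<theta> \<mu> < ereal (real DIM('a) * \<theta>)" "q < ennreal (2 / \<theta>)"
      using less unfolding less_Sup_iff by blast
    have inf: "(\<integral>\<^sup>+ \<xi>. ennreal (norm (F \<xi>) powr (2 / \<theta>)) \<partial>lborel) = \<infinity>"
      using \<theta> energy_J_critical energy_J_eq_top_of_spectrum_less by blast
    obtain r where r: "0 \<le> r" "q = ennreal r"
      using \<theta>(3) by (cases q) auto
    then have "1 \<le> r" "r \<le> 2 / \<theta>"
      using q \<theta> by (auto simp: ennreal_less_iff)
    then show "\<not> restriction_estimate \<mu> p q"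
      unfolding r by (rule not_restriction_estimate[OF inf _ _ p])
  qed
qed

end
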